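(* For every BBI formula $A$: if $A$ is valid (forced at every world of every model), then for every label variable $w\in LVar$ the sequent $\emptyset\vdash w:A$ (empty antecedent) is derivable in $LS_{BBI}$.
   Context: BBI formulae: $A ::= p \mid \top \mid \bot \mid \neg A \mid A\lor A \mid A\land A \mid A\to A \mid \top^* \mid A * A \mid A \mathrel{-\!*} A$, $p$ atomic; in the calculus $\neg A$ abbreviates $A\to\bot$ and $A\lor B$ abbreviates $\neg(\neg A\land\neg B)$. Semantics. A frame is $(\mathcal{M},\triangleright,\epsilon)$ with $\mathcal{M}$ nonempty, $\epsilon\in\mathcal{M}$, $\triangleright\subseteq\mathcal{M}^3$ (written $a,b\triangleright c$) such that for all $a,b,c,d$: $\epsilon,a\triangleright b$ iff $a=b$; $a,b\triangleright c$ iff $b,a\triangleright c$; if $a,k\triangleright d$ and $b,c\triangleright k$ for some $k$, then there is $l$ with $a,b\triangleright l$ and $l,c\triangleright d$. A model adds a valuation $v$ from atoms to subsets of $\mathcal{M}$. Forcing: $m\Vdash p$ iff $m\in v(p)$; $m\Vdash\top^*$ iff $m=\epsilon$; $\top$ always, $\bot$ never; $\land,\lor,\to,\neg$ classical pointwise; $m\Vdash A*B$ iff there are $a,b$ with $a,b\triangleright m$, $a\Vdash A$, $b\Vdash B$; $m\Vdash A\mathrel{-\!*}B$ iff for all $a,b$, if $m,a\triangleright b$ and $a\Vdash A$ then $b\Vdash B$. $A$ is valid iff $m\Vdash A$ for every $m$ in every model. Syntax of sequents. Labels are label variables (from an infinite set $LVar$) or the constant $\epsilon$. A labelled formula is $w:A$;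 a relational atom is $(x,y\triangleright z)$ for labels $x,y,z$. A sequent $\Gamma\vdash\Delta$ has $\Gamma$ a finite multiset of labelled formulae and relational atoms and $\Delta$ a finite multiset of labelled formulae; ";" is multiset union. $\Gamma[y/x]$ replaces every occurrence of label $x$ by $y$. Rules of $LS_{BBI}$ ("from premises infer conclusion"; $P$ atomic): id: infer $\Gamma;w:P\vdash w:P;\Delta$. $\bot L$: infer $\Gamma;w:\bot\vdash\Delta$. $\top R$: infer $\Gamma\vdash w:\top;\Delta$. $\top^*R$: infer $\Gamma\vdash\epsilon:\top^*;\Delta$. cut: from $\Gamma\vdash x:A;\Delta$ and $\Gamma';x:A\vdash\Delta'$ infer $\Gamma;\Gamma'\vdash\Delta;\Delta'$. $\top^*L$: from $\Gamma[\epsilon/w]\vdash\Delta[\epsilon/w]$ infer $\Gamma;w:\top^*\vdash\Delta$ ($w\neq\epsilon$). $\land L$: from $\Gamma;w:A;w:B\vdash\Delta$ infer $\Gamma;w:A\land B\vdash\Delta$. $\land R$: from $\Gamma\vdash w:A;\Delta$ and $\Gamma\vdash w:B;\Delta$ infer $\Gamma\vdash w:A\land B;\Delta$. $\to L$: from $\Gamma\vdash w:A;\Delta$ and $\Gamma;w:B\vdash\Delta$ infer $\Gamma;w:A\to B\vdash\Delta$. $\to R$: from $\Gamma;w:A\vdash w:B;\Delta$ infer $\Gamma\vdash w:A\to B;\Delta$. $*L$: from $(x,y\triangleright z);\Gamma;x:A;y:B\vdash\Delta$ infer $\Gamma;z:A*B\vdash\Delta$ ($x,y$ not in the conclusion).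 $\mathrel{-\!*}R$: from $(x,y\triangleright z);\Gamma;x:A\vdash z:B;\Delta$ infer $\Gamma\vdash y:A\mathrel{-\!*}B;\Delta$ ($x,z$ not in the conclusion). $*R$: from $(x,y\triangleright z);\Gamma\vdash x:A;z:A*B;\Delta$ and $(x,y\triangleright z);\Gamma\vdash y:B;z:A*B;\Delta$ infer $(x,y\triangleright z);\Gamma\vdash z:A*B;\Delta$. $\mathrel{-\!*}L$: from $(x,y\triangleright z);\Gamma;y:A\mathrel{-\!*}B\vdash x:A;\Delta$ and $(x,y\triangleright z);\Gamma;y:A\mathrel{-\!*}B;z:B\vdash\Delta$ infer $(x,y\triangleright z);\Gamma;y:A\mathrel{-\!*}B\vdash\Delta$. E: from $(y,x\triangleright z);(x,y\triangleright z);\Gamma\vdash\Delta$ infer $(x,y\triangleright z);\Gamma\vdash\Delta$. U: from $(x,\epsilon\triangleright x);\Gamma\vdash\Delta$ infer $\Gamma\vdash\Delta$. A: from $(u,w\triangleright z);(y,v\triangleright w);(x,y\triangleright z);(u,v\triangleright x);\Gamma\vdash\Delta$ infer $(x,y\triangleright z);(u,v\triangleright x);\Gamma\vdash\Delta$ ($w$ not in the conclusion). $A_C$: from $(x,w\triangleright x);(y,y\triangleright w);(x,y\triangleright x);\Gamma\vdash\Delta$ infer $(x,y\triangleright x);\Gamma\vdash\Delta$ ($w$ not in the conclusion). $Eq_1$: from $(\epsilon,w'\triangleright w');\Gamma[w'/w]\vdash\Delta[w'/w]$ infer $(\epsilon,w\triangleright w');\Gamma\vdash\Delta$ ($w\neq\epsilon$).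 $Eq_2$: from $(\epsilon,w'\triangleright w');\Gamma[w'/w]\vdash\Delta[w'/w]$ infer $(\epsilon,w'\triangleright w);\Gamma\vdash\Delta$ ($w\neq\epsilon$). *)

theory Defs
  imports "HOL-Library.Multiset"
begin

datatype 'p fm =
    Atom 'p | Top | Bot | Neg "'p fm" | Or "'p fm" "'p fm" | And "'p fm" "'p fm"
  | Imp "'p fm" "'p fm" | Emp | Star "'p fm" "'p fm" | Wand "'p fm" "'p fm"

(* (a, b, c) \<in> R encodes a, b \<triangleright> c.  Nonemptiness of M follows from e \<in> M. *)
definition frame :: "'m set \<Rightarrow> ('m \<times> 'm \<times> 'm) set \<Rightarrow> 'm \<Rightarrow> bool" where
  "frame M R e \<longleftrightarrow>
     e \<in> M \<and> R \<subseteq> M \<times> M \<times> M \<and>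
     (\<forall>a\<in>M. \<forall>b\<in>M. (e, a, b) \<in> R \<longleftrightarrow> a = b) \<and>
     (\<forall>a\<in>M. \<forall>b\<in>M. \<forall>c\<in>M. (a, b, c) \<in> R \<longleftrightarrow> (b, a, c) \<in> R) \<and>
     (\<forall>a\<in>M. \<forall>b\<in>M. \<forall>c\<in>M. \<forall>d\<in>M.
        (\<exists>k\<in>M. (a, k, d) \<in> R \<and> (b, c, k) \<in> R) \<longrightarrow>
        (\<exists>l\<in>M. (a, b, l) \<in> R \<and> (l, c, d) \<in> R))"

definition model :: "'m set \<Rightarrow> ('m \<times> 'm \<times> 'm) set \<Rightarrow> 'm \<Rightarrow> ('p \<Rightarrow> 'm set) \<Rightarrow> bool" where
  "model M R e v \<longleftrightarrow> frame M R e \<and> (\<forall>p. v p \<subseteq> M)"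

(* The quantifiers over worlds need no bound M, since R \<subseteq> M \<times> M \<times> M in a frame. *)
primrec forces :: "('m \<times> 'm \<times> 'm) set \<Rightarrow> 'm \<Rightarrow> ('p \<Rightarrow> 'm set) \<Rightarrow> 'm \<Rightarrow> 'p fm \<Rightarrow> bool" where
  "forces R e v m (Atom p) \<longleftrightarrow> m \<in> v p"
| "forces R e v m Top \<longleftrightarrow> True"
| "forces R e v m Bot \<longleftrightarrow> False"
| "forces R e v m (Neg A) \<longleftrightarrow> \<not> forces R e v m A"
| "forces R e v m (Or A B) \<longleftrightarrow> forces R e v m A \<or> forces R e v m B"
| "forces R e v m (And A B) \<longleftrightarrow> forces R e v m A \<and> forces R e v m B"
| "forces R e v m (Imp A B) \<longleftrightarrow> (forces R e v m A \<longrightarrow> forces R e v m B)"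
| "forces R e v m Emp \<longleftrightarrow> m = e"
| "forces R e v m (Star A B) \<longleftrightarrow>
     (\<exists>a b. (a, b, m) \<in> R \<and> forces R e v a A \<and> forces R e v b B)"
| "forces R e v m (Wand A B) \<longleftrightarrow>
     (\<forall>a b. (m, a, b) \<in> R \<and> forces R e v a A \<longrightarrow> forces R e v b B)"

(* HOL cannot quantify over all types inside a formula, so validity is indexed by the type 'm
   from which the carriers of the models are taken.  Carriers are arbitrary subsets of 'm. *)
definition valid :: "'m itself \<Rightarrow> 'p fm \<Rightarrow> bool" where
  "valid (_ :: 'm itself) A \<longleftrightarrow>
     (\<forall>(M :: 'm set) R e v. model M R e v \<longrightarrow> (\<forall>m\<in>M. forces R e v m A))"

(* Formulae as they occur in the calculus, where negation and disjunction are abbreviations. *)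
datatype 'p cfm =
    CAtom 'p | CTop | CBot | CAnd "'p cfm" "'p cfm" | CImp "'p cfm" "'p cfm"
  | CEmp | CStar "'p cfm" "'p cfm" | CWand "'p cfm" "'p cfm"

abbreviation CNeg :: "'p cfm \<Rightarrow> 'p cfm" where
  "CNeg A \<equiv> CImp A CBot"

abbreviation COr :: "'p cfm \<Rightarrow> 'p cfm \<Rightarrow> 'p cfm" where
  "COr A B \<equiv> CNeg (CAnd (CNeg A) (CNeg B))"

primrec unabbrev :: "'p fm \<Rightarrow> 'p cfm" where
  "unabbrev (Atom p) = CAtom p"
| "unabbrev Top = CTop"
| "unabbrev Bot = CBot"
| "unabbrev (Neg A) = CNeg (unabbrev A)"
| "unabbrev (Or A B) = COr (unabbrev A) (unabbrev B)"
| "unabbrev (And A B) = CAnd (unabbrev A) (unabbrev B)"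
| "unabbrev (Imp A B) = CImp (unabbrev A) (unabbrev B)"
| "unabbrev Emp = CEmp"
| "unabbrev (Star A B) = CStar (unabbrev A) (unabbrev B)"
| "unabbrev (Wand A B) = CWand (unabbrev A) (unabbrev B)"

datatype 'l label = Eps | Var 'l

type_synonym ('l, 'p) lform = "'l label \<times> 'p cfm"

(* Rel x y z is the relational atom (x, y \<triangleright> z). *)
datatype ('l, 'p) item =
    Fm "'l label" "'p cfm"
  | Rel "'l label" "'l label" "'l label"

(* The substitutions [y/x]: x is replaced by y. *)
definition sub :: "'l label \<Rightarrow> 'l label \<Rightarrow> 'l label \<Rightarrow> 'l label" where
  "sub y x u = (if u = x then y else u)"

primrec sub_item :: "'l label \<Rightarrow> 'l label \<Rightarrow> ('l, 'p) item \<Rightarrow> ('l, 'p) item" where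
  "sub_item y x (Fm u A) = Fm (sub y x u) A"
| "sub_item y x (Rel a b c) = Rel (sub y x a) (sub y x b) (sub y x c)"

definition subL ::
    "'l label \<Rightarrow> 'l label \<Rightarrow> ('l, 'p) item multiset \<Rightarrow> ('l, 'p) item multiset" where
  "subL y x \<Gamma> = image_mset (sub_item y x) \<Gamma>"

definition subR ::
    "'l label \<Rightarrow> 'l label \<Rightarrow> ('l, 'p) lform multiset \<Rightarrow> ('l, 'p) lform multiset" where
  "subR y x \<Delta> = image_mset (\<lambda>(u, A). (sub y x u, A)) \<Delta>"

primrec item_labels :: "('l, 'p) item \<Rightarrow> 'l label set" where
  "item_labels (Fm u A) = {u}"
| "item_labels (Rel a b c) = {a, b, c}"

definition seq_labels ::
    "('l, 'p) item multiset \<Rightarrow> ('l, 'p) lform multiset \<Rightarrow> 'l label set" where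
  "seq_labels \<Gamma> \<Delta> = (\<Union>i \<in> set_mset \<Gamma>. item_labels i) \<union> fst ` set_mset \<Delta>"

(* Labels required not to occur in the conclusion are label variables (never Eps), and two
   such labels in the same rule are distinct: these are the usual eigenvariable conventions,
   without which starL and wandR would be unsound. *)
inductive derivable ::
    "('l, 'p) item multiset \<Rightarrow> ('l, 'p) lform multiset \<Rightarrow> bool" (infix "\<turnstile>" 50) where
  ax: "{#Fm w (CAtom p)#} + \<Gamma> \<turnstile> {#(w, CAtom p)#} + \<Delta>"
| botL: "{#Fm w CBot#} + \<Gamma> \<turnstile> \<Delta>"
| topR: "\<Gamma> \<turnstile> {#(w, CTop)#} + \<Delta>"
| empR: "\<Gamma> \<turnstile> {#(Eps, CEmp)#} + \<Delta>"
| cut: "\<Gamma> \<turnstile> {#(x, A)#} + \<Delta> \<Longrightarrow> {#Fm x A#} + \<Gamma>' \<turnstile> \<Delta>' \<Longrightarrow> \<Gamma> + \<Gamma>' \<turnstile> \<Delta> + \<Delta>'"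
| empL: "subL Eps w \<Gamma> \<turnstile> subR Eps w \<Delta> \<Longrightarrow> w \<noteq> Eps \<Longrightarrow> {#Fm w CEmp#} + \<Gamma> \<turnstile> \<Delta>"
| andL: "{#Fm w A, Fm w B#} + \<Gamma> \<turnstile> \<Delta> \<Longrightarrow> {#Fm w (CAnd A B)#} + \<Gamma> \<turnstile> \<Delta>"
| andR: "\<Gamma> \<turnstile> {#(w, A)#} + \<Delta> \<Longrightarrow> \<Gamma> \<turnstile> {#(w, B)#} + \<Delta> \<Longrightarrow> \<Gamma> \<turnstile> {#(w, CAnd A B)#} + \<Delta>"
| impL: "\<Gamma> \<turnstile> {#(w, A)#} + \<Delta> \<Longrightarrow> {#Fm w B#} + \<Gamma> \<turnstile> \<Delta> \<Longrightarrow> {#Fm w (CImp A B)#} + \<Gamma> \<turnstile> \<Delta>"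
| impR: "{#Fm w A#} + \<Gamma> \<turnstile> {#(w, B)#} + \<Delta> \<Longrightarrow> \<Gamma> \<turnstile> {#(w, CImp A B)#} + \<Delta>"
| starL:
    "{#Rel (Var x) (Var y) z, Fm (Var x) A, Fm (Var y) B#} + \<Gamma> \<turnstile> \<Delta> \<Longrightarrow>
     x \<noteq> y \<Longrightarrow>
     Var x \<notin> seq_labels ({#Fm z (CStar A B)#} + \<Gamma>) \<Delta> \<Longrightarrow>
     Var y \<notin> seq_labels ({#Fm z (CStar A B)#} + \<Gamma>) \<Delta> \<Longrightarrow>
     {#Fm z (CStar A B)#} + \<Gamma> \<turnstile> \<Delta>"
| wandR:
    "{#Rel (Var x) y (Var z), Fm (Var x) A#} + \<Gamma> \<turnstile> {#(Var z, B)#} + \<Delta> \<Longrightarrow>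
     x \<noteq> z \<Longrightarrow>
     Var x \<notin> seq_labels \<Gamma> ({#(y, CWand A B)#} + \<Delta>) \<Longrightarrow>
     Var z \<notin> seq_labels \<Gamma> ({#(y, CWand A B)#} + \<Delta>) \<Longrightarrow>
     \<Gamma> \<turnstile> {#(y, CWand A B)#} + \<Delta>"
| starR:
    "{#Rel x y z#} + \<Gamma> \<turnstile> {#(x, A), (z, CStar A B)#} + \<Delta> \<Longrightarrow>
     {#Rel x y z#} + \<Gamma> \<turnstile> {#(y, B), (z, CStar A B)#} + \<Delta> \<Longrightarrow>
     {#Rel x y z#} + \<Gamma> \<turnstile> {#(z, CStar A B)#} + \<Delta>"
| wandL:
    "{#Rel x y z, Fm y (CWand A B)#} + \<Gamma> \<turnstile> {#(x, A)#} + \<Delta> \<Longrightarrow>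
     {#Rel x y z, Fm y (CWand A B), Fm z B#} + \<Gamma> \<turnstile> \<Delta> \<Longrightarrow>
     {#Rel x y z, Fm y (CWand A B)#} + \<Gamma> \<turnstile> \<Delta>"
| E: "{#Rel y x z, Rel x y z#} + \<Gamma> \<turnstile> \<Delta> \<Longrightarrow> {#Rel x y z#} + \<Gamma> \<turnstile> \<Delta>"
| U: "{#Rel x Eps x#} + \<Gamma> \<turnstile> \<Delta> \<Longrightarrow> \<Gamma> \<turnstile> \<Delta>"
| A:
    "{#Rel u (Var w) z, Rel y v (Var w), Rel x y z, Rel u v x#} + \<Gamma> \<turnstile> \<Delta> \<Longrightarrow>
     Var w \<notin> seq_labels ({#Rel x y z, Rel u v x#} + \<Gamma>) \<Delta> \<Longrightarrow>
     {#Rel x y z, Rel u v x#} + \<Gamma> \<turnstile> \<Delta>"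
| AC:
    "{#Rel x (Var w) x, Rel y y (Var w), Rel x y x#} + \<Gamma> \<turnstile> \<Delta> \<Longrightarrow>
     Var w \<notin> seq_labels ({#Rel x y x#} + \<Gamma>) \<Delta> \<Longrightarrow>
     {#Rel x y x#} + \<Gamma> \<turnstile> \<Delta>"
| Eq1:
    "{#Rel Eps w' w'#} + subL w' w \<Gamma> \<turnstile> subR w' w \<Delta> \<Longrightarrow> w \<noteq> Eps \<Longrightarrow>
     {#Rel Eps w w'#} + \<Gamma> \<turnstile> \<Delta>"
| Eq2:
    "{#Rel Eps w' w'#} + subL w' w \<Gamma> \<turnstile> subR w' w \<Delta> \<Longrightarrow> w \<noteq> Eps \<Longrightarrow>
     {#Rel Eps w' w#} + \<Gamma> \<turnstile> \<Delta>"

end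

(*
  Suppose that w : A is not derivable.  Working with finite multisets drawn from a possibly infinite
  set of left-hand items, call the set consistent if no such multiset derives the empty succedent.
  The set {w : \<not>A} is consistent and extends to a maximal consistent set X that contains witnesses for
  *L, for -*R and for associativity; thanks to cut, X decides every labelled formula.  The relational
  atoms \<epsilon>, a \<triangleright> b in X form a congruence on labels, and the quotient is a countable model in which
  the class of a forces B iff a : B is in X.  Hence A fails at w.
*)

theory Submission
  imports Defs "HOL-Library.Countable" "HOL-Library.Infinite_Typeclass"
begin

subsection \<open>Structural rules\<close>

text \<open>Weakening, contraction and substitution of labels are not rules of the calculus, yet the
  Henkin argument needs all three. They are entangled: weakening must move eigenvariables away from
  the added context, which is a renaming, and renaming meets the rules \<open>empL\<close>,
  \<open>Eq1\<close>, \<open>Eq2\<close>, which rewrite whole sequents and may see distinct labels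
  become equal. One theorem therefore treats arbitrary renamings that fix \<open>Eps\<close>
  together with added context. Left sides alone suffice for consistency because classically a
  succedent formula is a negated antecedent formula. The stages of the Henkin construction stay
  finite, so that fresh labels never run out. The remaining obstacle is cardinality: validity
  concerns carriers within one infinite type \<open>'m\<close>, so the quotient should be countable,
  while the labels and atoms of the theorem may be uncountable.\<close>

primrec ren_item :: "('a label \<Rightarrow> 'b label) \<Rightarrow> ('p \<Rightarrow> 'q) \<Rightarrow> ('a, 'p) item \<Rightarrow> ('b, 'q) item" where
  "ren_item \<sigma> h (Fm u A) = Fm (\<sigma> u) (map_cfm h A)"
| "ren_item \<sigma> h (Rel a b c) = Rel (\<sigma> a) (\<sigma> b) (\<sigma> c)"

abbreviation ren_lform :: "('a label \<Rightarrow> 'b label) \<Rightarrow> ('p \<Rightarrow> 'q) \<Rightarrow> ('a, 'p) lform \<Rightarrow> ('b, 'q) lform" where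
  "ren_lform \<sigma> h \<equiv> map_prod \<sigma> (map_cfm h)"

abbreviation renL where "renL \<sigma> h \<equiv> image_mset (ren_item \<sigma> h)"
abbreviation renR where "renR \<sigma> h \<equiv> image_mset (ren_lform \<sigma> h)"

section \<open>Renaming, substitution and the labels of a sequent\<close>

lemma subL_simps [simp]:
  "subL y x {#} = {#}" "subL y x (add_mset i \<Gamma>) = add_mset (sub_item y x i) (subL y x \<Gamma>)"
  "subL y x (\<Gamma> + \<Gamma>') = subL y x \<Gamma> + subL y x \<Gamma>'"
  by (simp_all add: subL_def)

lemma subR_simps [simp]:
  "subR y x {#} = {#}" "subR y x (add_mset (u, A) \<Delta>) = add_mset (sub y x u, A) (subR y x \<Delta>)"
  "subR y x (\<Delta> + \<Delta>') = subR y x \<Delta> + subR y x \<Delta>'"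
  by (simp_all add: subR_def)

lemma ren_item_id [simp]: "ren_item id id = id"
  by (rule ext, rename_tac i, case_tac i) (simp_all add: cfm.map_id)

lemma ren_item_comp: "ren_item \<tau> k (ren_item \<sigma> h i) = ren_item (\<tau> \<circ> \<sigma>) (k \<circ> h) i"
  by (cases i) (simp_all add: cfm.map_comp)

lemma renL_comp: "renL \<tau> k (renL \<sigma> h \<Gamma>) = renL (\<tau> \<circ> \<sigma>) (k \<circ> h) \<Gamma>"
  by (simp add: multiset.map_comp comp_def ren_item_comp)

lemma renR_comp: "renR \<tau> k (renR \<sigma> h \<Delta>) = renR (\<tau> \<circ> \<sigma>) (k \<circ> h) \<Delta>"
  by (simp add: multiset.map_comp prod.map_comp cfm.map_comp comp_def)

lemma sub_item_ren: "sub_item y x = ren_item (sub y x) id"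
  by (rule ext, rename_tac i, case_tac i) (simp_all add: cfm.map_id)

lemma subL_ren: "subL y x (renL \<sigma> h \<Gamma>) = renL (sub y x \<circ> \<sigma>) h \<Gamma>"
  by (simp add: subL_def sub_item_ren ren_item_comp multiset.map_comp comp_def)

lemma subR_ren: "subR y x (renR \<sigma> h \<Delta>) = renR (sub y x \<circ> \<sigma>) h \<Delta>"
  by (simp add: subR_def multiset.map_comp comp_def case_prod_beta' map_prod_def)

lemma ren_subL: "renL \<sigma> h (subL y x \<Gamma>) = renL (\<sigma> \<circ> sub y x) h \<Gamma>"
  by (simp add: subL_def sub_item_ren ren_item_comp multiset.map_comp comp_def)

lemma ren_subR: "renR \<sigma> h (subR y x \<Delta>) = renR (\<sigma> \<circ> sub y x) h \<Delta>"
  by (simp add: subR_def multiset.map_comp comp_def case_prod_beta' map_prod_def)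

text \<open>Needed for the premises of \<open>empL\<close>, \<open>Eq1\<close> and
  \<open>Eq2\<close>: a renaming that already identifies the two labels absorbs the substitution
  made by the rule.\<close>

lemma merge_sub: "\<sigma> y = \<sigma> x \<Longrightarrow> \<sigma> \<circ> sub y x = \<sigma>"
  by (auto simp: sub_def)

lemma seq_labels_simps [simp]:
  "seq_labels {#} {#} = {}"
  "seq_labels (add_mset i \<Gamma>) \<Delta> = item_labels i \<union> seq_labels \<Gamma> \<Delta>"
  "seq_labels (\<Gamma> + \<Gamma>') (\<Delta> + \<Delta>') = seq_labels \<Gamma> \<Delta> \<union> seq_labels \<Gamma>' \<Delta>'"
  "seq_labels \<Gamma> (add_mset f \<Delta>) = insert (fst f) (seq_labels \<Gamma> \<Delta>)"
  by (auto simp: seq_labels_def)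

lemma finite_item_labels: "finite (item_labels i)"
  by (cases i) simp_all

lemma finite_seq_labels: "finite (seq_labels \<Gamma> \<Delta>)"
  by (simp add: seq_labels_def finite_item_labels)

text \<open>Allows a renaming to be redirected at eigenvariables without affecting the rest of the
  sequent.\<close>

lemma ren_cong:
  assumes "\<And>l. l \<in> seq_labels \<Gamma> \<Delta> \<Longrightarrow> \<sigma> l = \<tau> l"
  shows "renL \<sigma> h \<Gamma> = renL \<tau> h \<Gamma>" "renR \<sigma> h \<Delta> = renR \<tau> h \<Delta>"
proof -
  have "ren_item \<sigma> h i = ren_item \<tau> h i" if "i \<in># \<Gamma>" for i
  proof -
    have "\<sigma> l = \<tau> l" if "l \<in> item_labels i" for l
      using assms \<open>i \<in># \<Gamma>\<close> that by (auto simp: seq_labels_def)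
    then show ?thesis by (cases i) auto
  qed
  then show "renL \<sigma> h \<Gamma> = renL \<tau> h \<Gamma>" by (auto intro: image_mset_cong)
  have "ren_lform \<sigma> h f = ren_lform \<tau> h f" if "f \<in># \<Delta>" for f
    using assms that by (cases f) (auto simp: seq_labels_def rev_image_eqI)
  then show "renR \<sigma> h \<Delta> = renR \<tau> h \<Delta>" by (auto intro: image_mset_cong)
qed

lemma fresh_var:
  assumes "infinite (UNIV :: 'l set)" "finite (S :: 'l label set)"
  obtains x where "Var x \<notin> S"
proof -
  have "finite (Var -` S)" using assms(2) by (simp add: finite_vimageI inj_def)
  with assms(1) show ?thesis using that by (metis ex_new_if_finite vimageI)
qed

lemma fresh_vars:
  assumes "infinite (UNIV :: 'l set)" "finite (S :: 'l label set)"
  obtains x y where "Var x \<notin> S" "Var y \<notin> S" "x \<noteq> y"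
proof -
  obtain x where x: "Var x \<notin> S" using fresh_var assms by blast
  obtain y where "Var y \<notin> insert (Var x) S"
    using fresh_var[OF assms(1), of "insert (Var x) S"] assms(2) by blast
  with x that show ?thesis by auto
qed

text \<open>Renaming may identify labels, and then both an equality rule and its symmetric version are
  needed, since \<open>Eps\<close> is never replaced.\<close>

lemma merge_eq:
  fixes a b :: "'l label"
  assumes "\<And>\<sigma> :: 'l label \<Rightarrow> 'l label. \<sigma> Eps = Eps \<Longrightarrow> \<sigma> a = \<sigma> b \<Longrightarrow>
     renL \<sigma> id (add_mset (Rel Eps a b) \<Gamma>) \<turnstile> renR \<sigma> id \<Delta>"
  shows "add_mset (Rel Eps a b) \<Gamma> \<turnstile> \<Delta>"
proof (cases "a = b")
  case True
  show ?thesis using assms[of id] True by (simp add: cfm.map_id0 prod.map_id0)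
next
  case False
  have L: "subL y x \<Theta> = renL (sub y x) id \<Theta>" for x y and \<Theta> :: "('l, 'p) item multiset"
    by (simp add: subL_def sub_item_ren)
  have R: "subR y x \<Theta> = renR (sub y x) id \<Theta>" for x y and \<Theta> :: "('l, 'p) lform multiset"
    by (simp add: subR_def cfm.map_id0 map_prod_def)
  show ?thesis
  \<comment> \<open>The label to be replaced must be a variable: it is \<open>b\<close> if
    \<open>a\<close> is \<open>Eps\<close>, and \<open>a\<close> otherwise.\<close>
  proof (cases "a = Eps")
    case True
    then show ?thesis using assms[of "sub Eps b"] False Eq2[of Eps b \<Gamma> \<Delta>]
      by (auto simp: L R sub_def)
  next
    case a: False
    then show ?thesis using assms[of "sub b a"] False Eq1[of b a \<Gamma> \<Delta>]
      by (auto simp: L R sub_def)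
  qed
qed

text \<open>The induction hypothesis ranges over all renamings and contexts, so eigenvariables can
  be refreshed in a premise and the added context can be rewritten along with it. The renaming need
  not be injective; an infinite target type is what supplies fresh eigenvariables. Label and atom
  types may change, which later permits the passage from coded to original sequents.\<close>

theorem derivable_ren:
  fixes \<sigma> :: "'a label \<Rightarrow> 'b label" and h :: "'p \<Rightarrow> 'q"
  assumes "\<Gamma> \<turnstile> \<Delta>" "infinite (UNIV :: 'b set)" "\<sigma> Eps = Eps"
  shows "renL \<sigma> h \<Gamma> + \<Gamma>' \<turnstile> renR \<sigma> h \<Delta> + \<Delta>'"
  using assms(1,3)
proof (induction arbitrary: \<sigma> \<Gamma>' \<Delta>' rule: derivable.induct)
  case (ax w p \<Gamma> \<Delta>)
  show ?case using derivable.ax[of "\<sigma> w" "h p"] by simp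
next
  case (botL w \<Gamma> \<Delta>)
  show ?case using derivable.botL[of "\<sigma> w"] by simp
next
  case (topR \<Gamma> w \<Delta>)
  show ?case using derivable.topR[of _ "\<sigma> w"] by simp
next
  case (empR \<Gamma> \<Delta>)
  show ?case using derivable.empR empR by simp
next
  case (cut \<Gamma> x A \<Delta> \<Gamma>1 \<Delta>1)
  show ?case
    using derivable.cut[of "renL \<sigma> h \<Gamma> + \<Gamma>'" "\<sigma> x" "map_cfm h A" "renR \<sigma> h \<Delta> + \<Delta>'"
        "renL \<sigma> h \<Gamma>1" "renR \<sigma> h \<Delta>1"] cut.IH(1)[of \<sigma> \<Gamma>' \<Delta>', OF cut.prems] cut.IH(2)[of \<sigma> "{#}" "{#}", OF cut.prems]
    by (simp add: ac_simps)
next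
  case (empL w \<Gamma> \<Delta>)
  show ?case
  proof (cases "\<sigma> w = Eps")
    case True
    \<comment> \<open>No rule is applied here: the renamed premise already has the right context,
      and the formula \<open>CEmp\<close> at \<open>Eps\<close> is added by weakening.\<close>
    then show ?thesis using empL.IH[of \<sigma> "add_mset (Fm Eps CEmp) \<Gamma>'" \<Delta>'] empL.prems
      by (simp add: ren_subL ren_subR merge_sub)
  next
    case False
    \<comment> \<open>Applying \<open>empL\<close> at \<open>\<sigma> w\<close> also replaces the
      images of other labels sent to \<open>\<sigma> w\<close>, and labels of the added context. The
      hypothesis is therefore used for the composed renaming.\<close>
    let ?s = "sub Eps (\<sigma> w)"
    have s: "(?s \<circ> \<sigma>) \<circ> sub Eps w = ?s \<circ> \<sigma>"
      by (rule merge_sub) (use False empL.prems in \<open>auto simp: sub_def\<close>)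
    have "renL (?s \<circ> \<sigma>) h (subL Eps w \<Gamma>) + subL Eps (\<sigma> w) \<Gamma>' \<turnstile> renR (?s \<circ> \<sigma>) h (subR Eps w \<Delta>) + subR Eps (\<sigma> w) \<Delta>'"
      by (rule empL.IH) (use False empL.prems in \<open>auto simp: sub_def\<close>)
    then show ?thesis using derivable.empL[of "\<sigma> w" "renL \<sigma> h \<Gamma> + \<Gamma>'" "renR \<sigma> h \<Delta> + \<Delta>'"] False
      by (simp add: s ren_subL ren_subR subL_ren subR_ren)
  qed
next
  case (andL w A B \<Gamma> \<Delta>)
  show ?case
    using derivable.andL[where w = "\<sigma> w" and A = "map_cfm h A" and B = "map_cfm h B"]
      andL.IH[of \<sigma>, OF andL.prems]
    by simp
next
  case (andR \<Gamma> w A \<Delta> B)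
  show ?case
    using derivable.andR[where w = "\<sigma> w" and A = "map_cfm h A" and B = "map_cfm h B"]
      andR.IH[of \<sigma>, OF andR.prems]
    by simp
next
  case (impL \<Gamma> w A \<Delta> B)
  show ?case
    using derivable.impL[where w = "\<sigma> w" and A = "map_cfm h A" and B = "map_cfm h B"]
      impL.IH[of \<sigma>, OF impL.prems]
    by simp
next
  case (impR w A \<Gamma> B \<Delta>)
  show ?case
    using derivable.impR[where w = "\<sigma> w" and A = "map_cfm h A" and B = "map_cfm h B"]
      impR.IH[of \<sigma>, OF impR.prems]
    by simp
next
  case (starL x y z A B \<Gamma> \<Delta>)
  let ?\<Gamma> = "renL \<sigma> h \<Gamma> + \<Gamma>'" and ?\<Delta> = "renR \<sigma> h \<Delta> + \<Delta>'" and ?F = "Fm (\<sigma> z) (CStar (map_cfm h A) (map_cfm h B))"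
  obtain a b where ab: "Var a \<notin> seq_labels ({#?F#} + ?\<Gamma>) ?\<Delta>" "Var b \<notin> seq_labels ({#?F#} + ?\<Gamma>) ?\<Delta>" "a \<noteq> b"
    using fresh_vars[OF assms(2) finite_seq_labels] by blast
  \<comment> \<open>\<open>a\<close> and \<open>b\<close> avoid the added context too; since
    \<open>x\<close> and \<open>y\<close> do not occur in the conclusion, the redirection leaves it
    unchanged.\<close>
  define \<tau> where "\<tau> = \<sigma>(Var x := Var a, Var y := Var b)"
  have c: "renL \<tau> h \<Gamma> = renL \<sigma> h \<Gamma>" "renR \<tau> h \<Delta> = renR \<sigma> h \<Delta>" "\<tau> z = \<sigma> z"
    using starL.hyps by (auto simp: \<tau>_def intro!: ren_cong)
  have t: "\<tau> (Var x) = Var a" "\<tau> (Var y) = Var b" "\<tau> Eps = Eps"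
    using starL.hyps starL.prems by (auto simp: \<tau>_def)
  have "{#Rel (Var a) (Var b) (\<sigma> z), Fm (Var a) (map_cfm h A), Fm (Var b) (map_cfm h B)#} + ?\<Gamma> \<turnstile> ?\<Delta>"
    using starL.IH[of \<tau> \<Gamma>' \<Delta>', OF t(3)] by (simp add: c t)
  from derivable.starL[OF this ab(3,1,2)] show ?case by simp
next
  case (wandR x y z A \<Gamma> B \<Delta>)
  let ?\<Gamma> = "renL \<sigma> h \<Gamma> + \<Gamma>'" and ?\<Delta> = "renR \<sigma> h \<Delta> + \<Delta>'" and ?F = "(\<sigma> y, CWand (map_cfm h A) (map_cfm h B))"
  obtain a b where ab: "Var a \<notin> seq_labels ?\<Gamma> ({#?F#} + ?\<Delta>)" "Var b \<notin> seq_labels ?\<Gamma> ({#?F#} + ?\<Delta>)" "a \<noteq> b"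
    using fresh_vars[OF assms(2) finite_seq_labels] by blast
  define \<tau> where "\<tau> = \<sigma>(Var x := Var a, Var z := Var b)"
  have c: "renL \<tau> h \<Gamma> = renL \<sigma> h \<Gamma>" "renR \<tau> h \<Delta> = renR \<sigma> h \<Delta>" "\<tau> y = \<sigma> y"
    using wandR.hyps by (auto simp: \<tau>_def intro!: ren_cong)
  have t: "\<tau> (Var x) = Var a" "\<tau> (Var z) = Var b" "\<tau> Eps = Eps"
    using wandR.hyps wandR.prems by (auto simp: \<tau>_def)
  have "{#Rel (Var a) (\<sigma> y) (Var b), Fm (Var a) (map_cfm h A)#} + ?\<Gamma> \<turnstile> {#(Var b, map_cfm h B)#} + ?\<Delta>"
    using wandR.IH[of \<tau> \<Gamma>' \<Delta>', OF t(3)] by (simp add: c t)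
  from derivable.wandR[OF this ab(3,1,2)] show ?case by simp
next
  case (starR x y z \<Gamma> A B \<Delta>)
  show ?case
    using derivable.starR[of "\<sigma> x" "\<sigma> y" "\<sigma> z" _ "map_cfm h A"]
      starR.IH[of \<sigma>, OF starR.prems]
    by simp
next
  case (wandL x y z A B \<Gamma> \<Delta>)
  show ?case
    using derivable.wandL[of "\<sigma> x" "\<sigma> y" "\<sigma> z" "map_cfm h A" "map_cfm h B"]
      wandL.IH[of \<sigma>, OF wandL.prems]
    by simp
next
  case (E y x z \<Gamma> \<Delta>)
  show ?case
    using derivable.E[of "\<sigma> y" "\<sigma> x" "\<sigma> z" "renL \<sigma> h \<Gamma> + \<Gamma>'" "renR \<sigma> h \<Delta> + \<Delta>'"]
      E.IH[of \<sigma>, OF E.prems]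
    by simp
next
  case (U x \<Gamma> \<Delta>)
  show ?case
    using derivable.U[of "\<sigma> x" "renL \<sigma> h \<Gamma> + \<Gamma>'" "renR \<sigma> h \<Delta> + \<Delta>'"]
      U.IH[of \<sigma>, OF U.prems] U.prems
    by simp
next
  case (A u w z y v x \<Gamma> \<Delta>)
  let ?\<Gamma> = "renL \<sigma> h \<Gamma> + \<Gamma>'" and ?\<Delta> = "renR \<sigma> h \<Delta> + \<Delta>'"
  let ?F = "{#Rel (\<sigma> x) (\<sigma> y) (\<sigma> z), Rel (\<sigma> u) (\<sigma> v) (\<sigma> x)#}"
  obtain a where a: "Var a \<notin> seq_labels (?F + ?\<Gamma>) ?\<Delta>"
    using fresh_var[OF assms(2) finite_seq_labels] by blast
  define \<tau> where "\<tau> = \<sigma>(Var w := Var a)"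
  have c: "renL \<tau> h \<Gamma> = renL \<sigma> h \<Gamma>" "renR \<tau> h \<Delta> = renR \<sigma> h \<Delta>"
    "\<tau> x = \<sigma> x" "\<tau> y = \<sigma> y" "\<tau> z = \<sigma> z" "\<tau> u = \<sigma> u" "\<tau> v = \<sigma> v"
    using A.hyps by (auto simp: \<tau>_def intro!: ren_cong)
  have t: "\<tau> (Var w) = Var a" "\<tau> Eps = Eps" using A.prems by (auto simp: \<tau>_def)
  have "{#Rel (\<sigma> u) (Var a) (\<sigma> z), Rel (\<sigma> y) (\<sigma> v) (Var a), Rel (\<sigma> x) (\<sigma> y) (\<sigma> z), Rel (\<sigma> u) (\<sigma> v) (\<sigma> x)#} + ?\<Gamma> \<turnstile> ?\<Delta>"
    using A.IH[of \<tau> \<Gamma>' \<Delta>', OF t(2)] by (simp add: c t)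
  from derivable.A[OF this a] show ?case by simp
next
  case (AC x w y \<Gamma> \<Delta>)
  let ?\<Gamma> = "renL \<sigma> h \<Gamma> + \<Gamma>'" and ?\<Delta> = "renR \<sigma> h \<Delta> + \<Delta>'"
  obtain a where a: "Var a \<notin> seq_labels ({#Rel (\<sigma> x) (\<sigma> y) (\<sigma> x)#} + ?\<Gamma>) ?\<Delta>"
    using fresh_var[OF assms(2) finite_seq_labels] by blast
  define \<tau> where "\<tau> = \<sigma>(Var w := Var a)"
  have c: "renL \<tau> h \<Gamma> = renL \<sigma> h \<Gamma>" "renR \<tau> h \<Delta> = renR \<sigma> h \<Delta>" "\<tau> x = \<sigma> x" "\<tau> y = \<sigma> y"
    using AC.hyps by (auto simp: \<tau>_def intro!: ren_cong)
  have t: "\<tau> (Var w) = Var a" "\<tau> Eps = Eps" using AC.prems by (auto simp: \<tau>_def)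
  have "{#Rel (\<sigma> x) (Var a) (\<sigma> x), Rel (\<sigma> y) (\<sigma> y) (Var a), Rel (\<sigma> x) (\<sigma> y) (\<sigma> x)#} + ?\<Gamma> \<turnstile> ?\<Delta>"
    using AC.IH[of \<tau> \<Gamma>' \<Delta>', OF t(2)] by (simp add: c t)
  from derivable.AC[OF this a] show ?case by simp
next
  case (Eq1 w' w \<Gamma> \<Delta>)
  have "add_mset (Rel Eps (\<sigma> w) (\<sigma> w')) (renL \<sigma> h \<Gamma> + \<Gamma>') \<turnstile> renR \<sigma> h \<Delta> + \<Delta>'"
  proof (rule merge_eq)
    fix \<rho> :: "'b label \<Rightarrow> 'b label"
    assume \<rho>: "\<rho> Eps = Eps" "\<rho> (\<sigma> w) = \<rho> (\<sigma> w')"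
    \<comment> \<open>\<open>\<tau>\<close> identifies \<open>w\<close> and \<open>w'\<close>, so it
      absorbs the substitution in the premise and the induction hypothesis gives the required
      sequent.\<close>
    define \<tau> where "\<tau> = \<rho> \<circ> \<sigma>"
    have \<tau>: "\<rho> (\<sigma> l) = \<tau> l" for l by (simp add: \<tau>_def)
    from \<rho> show "renL \<rho> id (add_mset (Rel Eps (\<sigma> w) (\<sigma> w')) (renL \<sigma> h \<Gamma> + \<Gamma>')) \<turnstile> renR \<rho> id (renR \<sigma> h \<Delta> + \<Delta>')"
      using Eq1.IH[of \<tau> "renL \<rho> id \<Gamma>'" "renR \<rho> id \<Delta>'"] \<tau>[of Eps] Eq1.prems
      by (simp add: ren_subL ren_subR renL_comp renR_comp merge_sub \<tau> flip: \<tau>_def)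
  qed
  then show ?case using Eq1.prems by simp
next
  case (Eq2 w' w \<Gamma> \<Delta>)
  have "add_mset (Rel Eps (\<sigma> w') (\<sigma> w)) (renL \<sigma> h \<Gamma> + \<Gamma>') \<turnstile> renR \<sigma> h \<Delta> + \<Delta>'"
  proof (rule merge_eq)
    fix \<rho> :: "'b label \<Rightarrow> 'b label"
    assume \<rho>: "\<rho> Eps = Eps" "\<rho> (\<sigma> w') = \<rho> (\<sigma> w)"
    define \<tau> where "\<tau> = \<rho> \<circ> \<sigma>"
    have \<tau>: "\<rho> (\<sigma> l) = \<tau> l" for l by (simp add: \<tau>_def)
    from \<rho> show "renL \<rho> id (add_mset (Rel Eps (\<sigma> w') (\<sigma> w)) (renL \<sigma> h \<Gamma> + \<Gamma>')) \<turnstile> renR \<rho> id (renR \<sigma> h \<Delta> + \<Delta>')"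
      using Eq2.IH[of \<tau> "renL \<rho> id \<Gamma>'" "renR \<rho> id \<Delta>'"] \<tau>[of Eps] Eq2.prems
      by (simp add: ren_subL ren_subR renL_comp renR_comp merge_sub \<tau> flip: \<tau>_def)
  qed
  then show ?case using Eq2.prems by simp
qed


section \<open>Weakening, identity, contraction and negation\<close>

lemma weaken:
  fixes \<Gamma> :: "('l::infinite, 'p) item multiset"
  assumes "\<Gamma> \<turnstile> \<Delta>" "\<Gamma> \<subseteq># \<Gamma>'" "\<Delta> \<subseteq># \<Delta>'"
  shows "\<Gamma>' \<turnstile> \<Delta>'"
  using derivable_ren[OF assms(1) infinite_UNIV, of id id "\<Gamma>' - \<Gamma>" "\<Delta>' - \<Delta>"] assms(2,3)
  by (simp add: cfm.map_id0 prod.map_id0)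

text \<open>The axiom is restricted to atoms; on compound formulae the left and right rules match
  each other.\<close>

lemma identity:
  fixes \<Gamma> :: "('l::infinite, 'p) item multiset"
  shows "add_mset (Fm w A) \<Gamma> \<turnstile> add_mset (w, A) \<Delta>"
proof (induction A arbitrary: w \<Gamma> \<Delta>)
  case (CAtom p)
  show ?case using ax[of w p] by simp
next
  case CTop
  show ?case using topR[of _ w] by simp
next
  case CBot
  show ?case using botL[of w] by simp
next
  case (CAnd A B)
  show ?case
    using andL[of w A B \<Gamma> "add_mset (w, CAnd A B) \<Delta>"]
      andR[of "add_mset (Fm w A) (add_mset (Fm w B) \<Gamma>)" w A \<Delta> B]
      CAnd(1)[of w "add_mset (Fm w B) \<Gamma>" \<Delta>] CAnd(2)[of w "add_mset (Fm w A) \<Gamma>" \<Delta>]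
    by (simp add: add_mset_commute)
next
  case (CImp A B)
  show ?case
    using impR[of w A "add_mset (Fm w (CImp A B)) \<Gamma>" B \<Delta>]
      impL[of "add_mset (Fm w A) \<Gamma>" w A "add_mset (w, B) \<Delta>" B]
      CImp(1)[of w \<Gamma> "add_mset (w, B) \<Delta>"] CImp(2)[of w "add_mset (Fm w A) \<Gamma>" \<Delta>]
    by (simp add: add_mset_commute)
next
  case CEmp
  show ?case
  proof (cases "w = Eps")
    case True
    then show ?thesis using empR by simp
  next
    case False
    \<comment> \<open>\<open>empL\<close> rewrites the succedent as well, turning it into an
      instance of \<open>empR\<close>.\<close>
    then show ?thesis
      using empL[of w \<Gamma> "add_mset (w, CEmp) \<Delta>"] empR[of "subL Eps w \<Gamma>" "subR Eps w \<Delta>"]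
      by (simp add: sub_def)
  qed
next
  case (CStar A B)
  let ?\<Delta> = "add_mset (w, CStar A B) \<Delta>"
  obtain x y where xy: "Var x \<notin> seq_labels ({#Fm w (CStar A B)#} + \<Gamma>) ?\<Delta>"
    "Var y \<notin> seq_labels ({#Fm w (CStar A B)#} + \<Gamma>) ?\<Delta>" "x \<noteq> y"
    using fresh_vars[OF infinite_UNIV finite_seq_labels] by blast
  have "{#Rel (Var x) (Var y) w, Fm (Var x) A, Fm (Var y) B#} + \<Gamma> \<turnstile> ?\<Delta>"
    using starR[of "Var x" "Var y" w "add_mset (Fm (Var x) A) (add_mset (Fm (Var y) B) \<Gamma>)" A B \<Delta>]
      CStar(1)[of "Var x" "add_mset (Rel (Var x) (Var y) w) (add_mset (Fm (Var y) B) \<Gamma>)" ?\<Delta>]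
      CStar(2)[of "Var y" "add_mset (Rel (Var x) (Var y) w) (add_mset (Fm (Var x) A) \<Gamma>)" ?\<Delta>]
    by (simp add: add_mset_commute)
  from starL[OF this xy(3,1,2)] show ?case by simp
next
  case (CWand A B)
  let ?\<Gamma> = "add_mset (Fm w (CWand A B)) \<Gamma>"
  obtain x z where xz: "Var x \<notin> seq_labels ?\<Gamma> ({#(w, CWand A B)#} + \<Delta>)"
    "Var z \<notin> seq_labels ?\<Gamma> ({#(w, CWand A B)#} + \<Delta>)" "x \<noteq> z"
    using fresh_vars[OF infinite_UNIV finite_seq_labels] by blast
  have "{#Rel (Var x) w (Var z), Fm (Var x) A#} + ?\<Gamma> \<turnstile> {#(Var z, B)#} + \<Delta>"
    using wandL[of "Var x" w "Var z" A B "add_mset (Fm (Var x) A) \<Gamma>" "add_mset (Var z, B) \<Delta>"]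
      CWand(1)[of "Var x" "add_mset (Rel (Var x) w (Var z)) ?\<Gamma>" "add_mset (Var z, B) \<Delta>"]
      CWand(2)[of "Var z" "add_mset (Rel (Var x) w (Var z)) (add_mset (Fm (Var x) A) ?\<Gamma>)" \<Delta>]
    by (simp add: add_mset_commute)
  from wandR[OF this xz(3,1,2)] show ?case by simp
qed

text \<open>Contraction is not among the rules: for formulae it comes from the shared contexts of \<open>andR\<close>,
  and for relational atoms from a double application of \<open>E\<close>.\<close>

lemma contract:
  fixes \<Gamma> :: "('l::infinite, 'p) item multiset"
  assumes "add_mset i (add_mset i \<Gamma>) \<turnstile> \<Delta>"
  shows "add_mset i \<Gamma> \<turnstile> \<Delta>"
proof (cases i)
  case (Fm w A)
  have "add_mset (Fm w (CAnd A A)) \<Gamma> \<turnstile> \<Delta>"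
    using andL[of w A A \<Gamma> \<Delta>] assms Fm by simp
  moreover have "{#Fm w A#} \<turnstile> {#(w, CAnd A A)#}"
    using andR[of "{#Fm w A#}" w A "{#}" A] identity[of w A "{#}" "{#}"] by simp
  ultimately show ?thesis using cut[of "{#Fm w A#}" w "CAnd A A" "{#}" \<Gamma> \<Delta>] Fm by simp
next
  case (Rel x y z)
  \<comment> \<open>The mirrored atom comes from weakening. Read from premise to conclusion,
    \<open>E\<close> deletes an atom in the presence of its mirror image: once a copy of the
    original, then the mirror image itself.\<close>
  have "{#Rel x y z, Rel y x z, Rel x y z#} + \<Gamma> \<turnstile> \<Delta>"
    using weaken[OF assms, of "add_mset (Rel y x z) (add_mset i (add_mset i \<Gamma>))" \<Delta>] Rel
    by (simp add: add_mset_commute subset_mset.add_increasing2 mset_subset_eq_add_mset_cancel)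
  then have "{#Rel y x z, Rel x y z#} + \<Gamma> \<turnstile> \<Delta>"
    using E[of x y z "add_mset (Rel x y z) \<Gamma>" \<Delta>] by (simp add: add_mset_commute)
  then show ?thesis using E[of y x z \<Gamma> \<Delta>] Rel by simp
qed

text \<open>Justifies passing from multisets to sets: items that already occur in \<open>N\<close>
  are absorbed, whatever their multiplicity.\<close>

lemma contract_set:
  fixes \<Gamma> :: "('l::infinite, 'p) item multiset"
  assumes "\<Gamma> + N \<turnstile> \<Delta>" "set_mset \<Gamma> \<subseteq> set_mset N"
  shows "N \<turnstile> \<Delta>"
  using assms
proof (induction \<Gamma>)
  case (add i \<Gamma>)
  then obtain N' where "N = add_mset i N'" by (auto dest: multi_member_split)
  then show ?case using add contract[of i "\<Gamma> + N'" \<Delta>] by simp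
qed simp

lemma neg_left:
  assumes "\<Gamma> \<turnstile> {#(w, A)#}"
  shows "add_mset (Fm w (CNeg A)) \<Gamma> \<turnstile> {#}"
  using impL[of \<Gamma> w A "{#}" CBot] botL[of w \<Gamma> "{#}"] assms by simp

text \<open>The classical direction: cut removes a double negation. Together with
  \<open>neg_left\<close> it trades a succedent formula for an item on the left.\<close>

lemma neg_right:
  fixes \<Gamma> :: "('l::infinite, 'p) item multiset"
  assumes "add_mset (Fm w (CNeg A)) \<Gamma> \<turnstile> {#}"
  shows "\<Gamma> \<turnstile> {#(w, A)#}"
proof -
  have "add_mset (Fm w (CNeg A)) \<Gamma> \<turnstile> {#(w, CBot)#}"
    using weaken[OF assms] by simp
  then have 1: "\<Gamma> \<turnstile> {#(w, CNeg (CNeg A))#}"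
    using impR[of w "CNeg A" \<Gamma> CBot "{#}"] by simp
  have "{#} \<turnstile> {#(w, CNeg A), (w, A)#}"
    using impR[of w A "{#}" CBot "{#(w, A)#}"] identity[of w A "{#}" "{#(w, CBot)#}"]
    by (simp add: add_mset_commute)
  then have "{#Fm w (CNeg (CNeg A))#} \<turnstile> {#(w, A)#}"
    using impL[of "{#}" w "CNeg A" "{#(w, A)#}" CBot] botL[of w "{#}" "{#(w, A)#}"]
    by (simp add: add_mset_commute)
  then show ?thesis using cut[of \<Gamma> w "CNeg (CNeg A)" "{#}" "{#}"] 1 by simp
qed

subsection \<open>Henkin sets\<close>

definition con :: "('l, 'p) item set \<Rightarrow> bool" where
  "con S \<longleftrightarrow> (\<forall>\<Gamma>. set_mset \<Gamma> \<subseteq> S \<longrightarrow> \<not> \<Gamma> \<turnstile> {#})"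

lemma con_mono: "con T \<Longrightarrow> S \<subseteq> T \<Longrightarrow> con S"
  by (auto simp: con_def)

text \<open>A refutation may use an item of \<open>N\<close> many times or not at all; weakening and
  contraction normalise this to exactly \<open>N\<close>.\<close>

lemma not_con_extend:
  fixes S :: "('l::infinite, 'p) item set"
  assumes "\<not> con (S \<union> set_mset N)"
  obtains \<Gamma> where "set_mset \<Gamma> \<subseteq> S" "N + \<Gamma> \<turnstile> {#}"
proof -
  obtain \<Gamma> where \<Gamma>: "set_mset \<Gamma> \<subseteq> S \<union> set_mset N" "\<Gamma> \<turnstile> {#}"
    using assms by (auto simp: con_def)
  let ?\<Gamma> = "filter_mset (\<lambda>i. i \<in> S) \<Gamma>"
  have "\<Gamma> + (N + ?\<Gamma>) \<turnstile> {#}" by (rule weaken[OF \<Gamma>(2)]) simp_all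
  then have "N + ?\<Gamma> \<turnstile> {#}" by (rule contract_set) (use \<Gamma>(1) in auto)
  then show ?thesis using that[of ?\<Gamma>] by auto
qed

text \<open>Makes a rule, read from conclusion to premise, an extension that preserves consistency:
  \<open>M\<close> holds the principal items and \<open>N\<close> what the premise adds.\<close>

lemma con_extend:
  fixes S :: "('l::infinite, 'p) item set"
  assumes "con S" "set_mset M \<subseteq> S"
    and "\<And>\<Gamma>. set_mset \<Gamma> \<subseteq> S \<Longrightarrow> N + (M + \<Gamma>) \<turnstile> {#} \<Longrightarrow> M + \<Gamma> \<turnstile> {#}"
  shows "con (S \<union> set_mset N)"
proof (rule ccontr)
  assume "\<not> con (S \<union> set_mset N)"
  then obtain \<Gamma> where \<Gamma>: "set_mset \<Gamma> \<subseteq> S" "N + \<Gamma> \<turnstile> {#}" by (rule not_con_extend)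
  have "N + (M + \<Gamma>) \<turnstile> {#}" by (rule weaken[OF \<Gamma>(2)]) simp_all
  with \<Gamma>(1) have "M + \<Gamma> \<turnstile> {#}" by (rule assms(3))
  with assms(1,2) \<Gamma>(1) show False by (auto simp: con_def)
qed

text \<open>Two items are considered at once because associativity has two principal atoms; the
  clauses for formulae inspect \<open>i\<close> only. The clause for \<open>wandR\<close> concerns a
  negated formula, since succedents have been moved to the left.\<close>

definition witnessed :: "('l, 'p) item \<Rightarrow> ('l, 'p) item \<Rightarrow> ('l, 'p) item set \<Rightarrow> bool" where
  "witnessed i j Z \<longleftrightarrow>
     (\<forall>z A B. i = Fm z (CStar A B) \<longrightarrow> (\<exists>x y. {Rel x y z, Fm x A, Fm y B} \<subseteq> Z)) \<and>
     (\<forall>y A B. i = Fm y (CNeg (CWand A B)) \<longrightarrow> (\<exists>x z. {Rel x y z, Fm x A, Fm z (CNeg B)} \<subseteq> Z)) \<and>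
     (\<forall>x y z u v. i = Rel x y z \<longrightarrow> j = Rel u v x \<longrightarrow> (\<exists>w. {Rel u w z, Rel y v w} \<subseteq> Z))"

lemma witnessed_mono: "witnessed i j Z \<Longrightarrow> Z \<subseteq> Z' \<Longrightarrow> witnessed i j Z'"
  unfolding witnessed_def insert_subset by blast

lemma witnessed_extend:
  fixes Z :: "('l::infinite, 'p) item set"
  assumes "finite Z" "con Z" "i \<in> Z" "j \<in> Z"
  obtains Z' where "Z \<subseteq> Z'" "finite Z'" "con Z'" "witnessed i j Z'"
proof -
  let ?L = "\<Union> (item_labels ` Z)"
  have fin: "finite ?L" using assms(1) by (simp add: finite_item_labels)
  have L: "l \<notin> seq_labels \<Gamma> {#}" if "l \<notin> ?L" "set_mset \<Gamma> \<subseteq> Z" for l \<Gamma>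
    using that by (auto simp: seq_labels_def)
  obtain x y where xy: "Var x \<notin> ?L" "Var y \<notin> ?L" "x \<noteq> y"
    using fresh_vars[OF infinite_UNIV fin] by blast
  consider (star) z A B where "i = Fm z (CStar A B)" | (wand) z A B where "i = Fm z (CNeg (CWand A B))"
    | (rel) u v a b c where "i = Rel a b c" "j = Rel u v a"
    | (other) "witnessed i j Z"
    unfolding witnessed_def by blast
  then show ?thesis
  proof cases
    case (star z A B)
    let ?N = "{#Rel (Var x) (Var y) z, Fm (Var x) A, Fm (Var y) B#}"
    have "con (Z \<union> set_mset ?N)"
    proof (rule con_extend[OF assms(2), of "{#i#}"])
      fix \<Gamma> assume \<Gamma>: "set_mset \<Gamma> \<subseteq> Z" "?N + ({#i#} + \<Gamma>) \<turnstile> {#}"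
      \<comment> \<open>The context still contains \<open>i\<close>, so the rule yields a second
        copy, which is then contracted.\<close>
      have "{#Fm z (CStar A B)#} + ({#i#} + \<Gamma>) \<turnstile> {#}"
        by (rule starL[OF \<Gamma>(2) xy(3)]; rule L) (use xy \<Gamma> assms(3) star in auto)
      then show "{#i#} + \<Gamma> \<turnstile> {#}" using contract star by simp
    qed (use assms(3) in auto)
    moreover have "witnessed i j (Z \<union> set_mset ?N)" using star by (auto simp: witnessed_def)
    ultimately show ?thesis using that[of "Z \<union> set_mset ?N"] assms(1) by auto
  next
    case (wand z A B)
    let ?N = "{#Rel (Var x) z (Var y), Fm (Var x) A, Fm (Var y) (CNeg B)#}"
    have "con (Z \<union> set_mset ?N)"
    proof (rule con_extend[OF assms(2), of "{#i#}"])
      fix \<Gamma> assume \<Gamma>: "set_mset \<Gamma> \<subseteq> Z" "?N + ({#i#} + \<Gamma>) \<turnstile> {#}"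
      have z: "z \<in> ?L" using assms(3) wand by force
      \<comment> \<open>Moving \<open>CNeg B\<close> to the right as \<open>B\<close> produces the
        premise of \<open>wandR\<close>; its conclusion then returns to the left as another copy of
        \<open>i\<close>.\<close>
      have "{#Rel (Var x) z (Var y), Fm (Var x) A#} + ({#i#} + \<Gamma>) \<turnstile> {#(Var y, B)#} + {#}"
        using neg_right[of "Var y" B "{#Rel (Var x) z (Var y), Fm (Var x) A#} + ({#i#} + \<Gamma>)"] \<Gamma>(2)
        by (simp add: add_mset_commute)
      then have "{#i#} + \<Gamma> \<turnstile> {#(z, CWand A B)#} + {#}"
      proof (rule wandR)
        have "seq_labels ({#i#} + \<Gamma>) ({#(z, CWand A B)#} + {#}) \<subseteq> ?L"
          using z \<Gamma>(1) assms(3) by (auto simp: seq_labels_def)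
        then show "Var x \<notin> seq_labels ({#i#} + \<Gamma>) ({#(z, CWand A B)#} + {#})"
          "Var y \<notin> seq_labels ({#i#} + \<Gamma>) ({#(z, CWand A B)#} + {#})"
          using xy by blast+
      qed (rule xy)
      then have "add_mset i ({#i#} + \<Gamma>) \<turnstile> {#}" using neg_left wand by fastforce
      then show "{#i#} + \<Gamma> \<turnstile> {#}" using contract by simp
    qed (use assms(3) in auto)
    moreover have "witnessed i j (Z \<union> set_mset ?N)" using wand by (auto simp: witnessed_def)
    ultimately show ?thesis using that[of "Z \<union> set_mset ?N"] assms(1) by auto
  next
    case (rel u v a b c)
    let ?N = "{#Rel u (Var x) c, Rel b v (Var x)#}"
    have "con (Z \<union> set_mset ?N)"
    proof (rule con_extend[OF assms(2), of "{#Rel a b c, Rel u v a#}"])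
      fix \<Gamma> assume \<Gamma>: "set_mset \<Gamma> \<subseteq> Z" "?N + ({#Rel a b c, Rel u v a#} + \<Gamma>) \<turnstile> {#}"
      show "{#Rel a b c, Rel u v a#} + \<Gamma> \<turnstile> {#}"
        by (rule A[of u x c b v a]) (use \<Gamma> in \<open>simp add: add_mset_commute\<close>, rule L, use xy \<Gamma> assms(3,4) rel in auto)
    qed (use assms(3,4) rel in auto)
    moreover have "witnessed i j (Z \<union> set_mset ?N)" using rel by (auto simp: witnessed_def)
    ultimately show ?thesis using that[of "Z \<union> set_mset ?N"] assms(1) by auto
  qed (use that assms in auto)
qed

instance label :: (countable) countable by countable_datatype
instance cfm :: (countable) countable by countable_datatype
instance item :: (countable, countable) countable by countable_datatype

text \<open>The enumeration ranges over pairs of items, so that every instance of associativity receives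
  its witness at the stage of the pair of its premises, however late these were added.\<close>

lemma henkin_extension:
  fixes S :: "('l::{infinite, countable}, 'p::countable) item set"
  assumes "finite S" "con S"
  obtains X where "S \<subseteq> X" "con X"
    "\<And>i j. con (X \<union> {i, j}) \<Longrightarrow> i \<in> X \<and> j \<in> X \<and> witnessed i j X"
proof -
  define P where "P = (\<lambda>n :: nat. \<lambda>Z. finite Z \<and> con Z \<and> S \<subseteq> Z)"
  define Q where "Q = (\<lambda>n Z (Z' :: ('l, 'p) item set). Z \<subseteq> Z' \<and> (case from_nat n of (i, j) \<Rightarrow>
     con (Z \<union> {i, j}) \<longrightarrow> i \<in> Z' \<and> j \<in> Z' \<and> witnessed i j Z'))"
  have "\<exists>f. \<forall>n. P n (f n) \<and> Q n (f n) (f (Suc n))"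
  proof (rule dependent_nat_choice)
    show "\<exists>Z. P 0 Z" using assms by (auto simp: P_def)
  next
    fix Z n assume Z: "P n Z"
    obtain i j where ij: "from_nat n = (i :: ('l, 'p) item, j :: ('l, 'p) item)" by fastforce
    show "\<exists>Z'. P (Suc n) Z' \<and> Q n Z Z'"
    proof (cases "con (Z \<union> {i, j})")
      case True
      obtain Z' where "Z \<union> {i, j} \<subseteq> Z'" "finite Z'" "con Z'" "witnessed i j Z'"
        using witnessed_extend[of "Z \<union> {i, j}" i j] True Z by (auto simp: P_def)
      then show ?thesis using Z ij by (intro exI[of _ Z']) (auto simp: P_def Q_def)
    next
      case False
      then show ?thesis using Z ij by (intro exI[of _ Z]) (auto simp: P_def Q_def)
    qed
  qed
  then obtain f where f: "\<And>n. P n (f n)" "\<And>n. Q n (f n) (f (Suc n))" by blast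
  have mono: "f m \<subseteq> f n" if "m \<le> n" for m n
    using lift_Suc_mono_le[of f m n] f(2) that by (auto simp: Q_def)
  define X where "X = (\<Union>n. f n)"
  have sub: "f n \<subseteq> X" for n by (auto simp: X_def)
  \<comment> \<open>Compactness: a refuting multiset has finite support and hence lies within a
    single stage.\<close>
  have "\<exists>n. T \<subseteq> f n" if "finite T" "T \<subseteq> X" for T
    using that
  proof (induction T)
    case (insert i T)
    then obtain m n where "T \<subseteq> f m" "i \<in> f n" by (auto simp: X_def)
    then have "insert i T \<subseteq> f (max m n)" using mono[of m "max m n"] mono[of n "max m n"] by auto
    then show ?case by blast
  qed simp
  then have con: "con X" using f(1) unfolding con_def P_def by (metis finite_set_mset)
  have "i \<in> X \<and> j \<in> X \<and> witnessed i j X" if "con (X \<union> {i, j})" for i j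
  proof -
    let ?n = "to_nat (i, j)"
    \<comment> \<open>Consistency with the union entails consistency with the smaller stage, so the
      pair was accepted when its turn came.\<close>
    have "con (f ?n \<union> {i, j})" by (rule con_mono[OF that]) (use sub in auto)
    then have "i \<in> f (Suc ?n) \<and> j \<in> f (Suc ?n) \<and> witnessed i j (f (Suc ?n))"
      using f(2)[of ?n] by (auto simp: Q_def)
    then show ?thesis using sub witnessed_mono by blast
  qed
  then show ?thesis using that[of X] con f(1)[of 0] sub[of 0] by (auto simp: P_def)
qed

subsection \<open>The canonical model\<close>

locale henkin =
  fixes X :: "('l::{infinite, countable}, 'p) item set"
  assumes con: "con X"
    and maximal: "con (X \<union> {i, j}) \<Longrightarrow> i \<in> X \<and> j \<in> X \<and> witnessed i j X"
begin

text \<open>Rules that delete \<open>i\<close> in the presence of \<open>M\<close>, read from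
  premise to conclusion, become closure properties of \<open>X\<close>. Using the pair
  \<open>i\<close>, \<open>i\<close> recovers ordinary maximality.\<close>

lemma closed:
  assumes "set_mset M \<subseteq> X" "\<And>\<Gamma>. add_mset i (M + \<Gamma>) \<turnstile> {#} \<Longrightarrow> M + \<Gamma> \<turnstile> {#}"
  shows "i \<in> X"
proof -
  have "con (X \<union> set_mset {#i#})"
  proof (rule con_extend[OF con assms(1)])
    fix \<Gamma> assume "{#i#} + (M + \<Gamma>) \<turnstile> {#}"
    then show "M + \<Gamma> \<turnstile> {#}" using assms(2)[of \<Gamma>] by simp
  qed
  then show ?thesis using maximal[of i i] by simp
qed

lemma witnessed: "i \<in> X \<Longrightarrow> j \<in> X \<Longrightarrow> witnessed i j X"
  using maximal[of i j] con by (metis Un_absorb2 empty_subsetI insert_subset)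

lemma deducible:
  assumes "set_mset M \<subseteq> X" "M \<turnstile> {#(w, A)#}"
  shows "Fm w A \<in> X"
proof (rule closed[OF assms(1)])
  fix \<Gamma> assume "add_mset (Fm w A) (M + \<Gamma>) \<turnstile> {#}"
  then have "M + (M + \<Gamma>) \<turnstile> {#}" using cut[of M w A "{#}" "M + \<Gamma>" "{#}"] assms(2) by simp
  then show "M + \<Gamma> \<turnstile> {#}" by (rule contract_set) simp
qed

section \<open>Membership in \<open>X\<close> and the connectives\<close>

lemma neg_iff: "Fm w (CNeg A) \<in> X \<longleftrightarrow> Fm w A \<notin> X"
proof
  assume n: "Fm w (CNeg A) \<in> X"
  show "Fm w A \<notin> X"
  proof
    assume "Fm w A \<in> X"
    moreover have "{#Fm w (CNeg A), Fm w A#} \<turnstile> {#}" by (rule neg_left[OF identity])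
    ultimately show False
      using con n unfolding con_def by (auto dest!: spec[of _ "{#Fm w (CNeg A), Fm w A#}"])
  qed
next
  assume "Fm w A \<notin> X"
  then have "\<not> con (X \<union> set_mset {#Fm w A#})" using maximal[of "Fm w A" "Fm w A"] by auto
  then obtain \<Gamma> where \<Gamma>: "set_mset \<Gamma> \<subseteq> X" "{#Fm w A#} + \<Gamma> \<turnstile> {#}" by (rule not_con_extend)
  have "{#Fm w A#} + \<Gamma> \<turnstile> {#(w, CBot)#} + {#}" by (rule weaken[OF \<Gamma>(2)]) simp_all
  then have "\<Gamma> \<turnstile> {#(w, CNeg A)#}" using impR[of w A \<Gamma> CBot "{#}"] by simp
  with \<Gamma>(1) show "Fm w (CNeg A) \<in> X" by (rule deducible)
qed

lemma bot_notin: "Fm w CBot \<notin> X"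
  using con botL[of w "{#}" "{#}"] unfolding con_def by (auto dest!: spec[of _ "{#Fm w CBot#}"])

lemma top_in: "Fm w CTop \<in> X"
  by (rule deducible[of "{#}"]) (use topR[of _ w "{#}"] in auto)

lemma imp_iff: "Fm w (CImp A B) \<in> X \<longleftrightarrow> (Fm w A \<in> X \<longrightarrow> Fm w B \<in> X)"
proof (intro iffI impI)
  assume "Fm w (CImp A B) \<in> X" "Fm w A \<in> X"
  then show "Fm w B \<in> X"
    using impL[of "{#Fm w A#}" w A "{#(w, B)#}" B] identity[of w A "{#}" "{#(w, B)#}"]
      identity[of w B "{#Fm w A#}" "{#}"]
    by (intro deducible[of "{#Fm w (CImp A B), Fm w A#}"]) (auto simp: add_mset_commute)
next
  assume *: "Fm w A \<in> X \<longrightarrow> Fm w B \<in> X"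
  show "Fm w (CImp A B) \<in> X"
  proof (cases "Fm w A \<in> X")
    case True
    then show ?thesis
      using * impR[of w A "{#Fm w B#}" B "{#}"] identity[of w B "{#Fm w A#}" "{#}"]
      by (intro deducible[of "{#Fm w B#}"]) (auto simp: add_mset_commute)
  next
    case False
    have "{#Fm w (CNeg A), Fm w A#} \<turnstile> {#(w, B)#}"
      by (rule weaken[OF neg_left[OF identity[of w A "{#}" "{#}"]]]) simp_all
    then show ?thesis
      using False neg_iff impR[of w A "{#Fm w (CNeg A)#}" B "{#}"]
      by (intro deducible[of "{#Fm w (CNeg A)#}"]) (auto simp: add_mset_commute)
  qed
qed

lemma and_iff: "Fm w (CAnd A B) \<in> X \<longleftrightarrow> Fm w A \<in> X \<and> Fm w B \<in> X"
proof (intro iffI conjI)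
  assume "Fm w (CAnd A B) \<in> X"
  then show "Fm w A \<in> X" "Fm w B \<in> X"
    using andL[of w A B "{#}"] identity[of w A "{#Fm w B#}" "{#}"] identity[of w B "{#Fm w A#}" "{#}"]
    by (auto intro!: deducible[of "{#Fm w (CAnd A B)#}"] simp: add_mset_commute)
next
  assume "Fm w A \<in> X \<and> Fm w B \<in> X"
  then show "Fm w (CAnd A B) \<in> X"
    using andR[of "{#Fm w A, Fm w B#}" w A "{#}" B] identity[of w A "{#Fm w B#}" "{#}"]
      identity[of w B "{#Fm w A#}" "{#}"]
    by (intro deducible[of "{#Fm w A, Fm w B#}"]) (auto simp: add_mset_commute)
qed

lemma rel_comm: "Rel x y z \<in> X \<Longrightarrow> Rel y x z \<in> X"
  by (rule closed[of "{#Rel x y z#}"]) (use E[of y x z] in auto)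

lemma star_iff:
  "Fm z (CStar A B) \<in> X \<longleftrightarrow> (\<exists>x y. Rel x y z \<in> X \<and> Fm x A \<in> X \<and> Fm y B \<in> X)"
proof
  assume "Fm z (CStar A B) \<in> X"
  then show "\<exists>x y. Rel x y z \<in> X \<and> Fm x A \<in> X \<and> Fm y B \<in> X"
    using witnessed[of "Fm z (CStar A B)" "Fm z (CStar A B)"] by (simp add: witnessed_def)
next
  assume "\<exists>x y. Rel x y z \<in> X \<and> Fm x A \<in> X \<and> Fm y B \<in> X"
  then obtain x y where "Rel x y z \<in> X" "Fm x A \<in> X" "Fm y B \<in> X" by blast
  then show "Fm z (CStar A B) \<in> X"
    using starR[of x y z "{#Fm x A, Fm y B#}" A B "{#}"]
      identity[of x A "{#Rel x y z, Fm y B#}" "{#(z, CStar A B)#}"]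
      identity[of y B "{#Rel x y z, Fm x A#}" "{#(z, CStar A B)#}"]
    by (intro deducible[of "{#Rel x y z, Fm x A, Fm y B#}"]) (auto simp: add_mset_commute)
qed

lemma wand_iff:
  "Fm y (CWand A B) \<in> X \<longleftrightarrow> (\<forall>x z. Rel y x z \<in> X \<and> Fm x A \<in> X \<longrightarrow> Fm z B \<in> X)"
proof (intro iffI allI impI)
  fix x z assume "Fm y (CWand A B) \<in> X" "Rel y x z \<in> X \<and> Fm x A \<in> X"
  then show "Fm z B \<in> X"
    \<comment> \<open>The rules for \<open>CWand\<close> place its label second in the relational
      atom, whereas forcing places it first.\<close>
    using rel_comm[of y x z] wandL[of x y z A B "{#Fm x A#}" "{#(z, B)#}"]
      identity[of x A "{#Rel x y z, Fm y (CWand A B)#}" "{#(z, B)#}"]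
      identity[of z B "{#Rel x y z, Fm y (CWand A B), Fm x A#}" "{#}"]
    by (intro deducible[of "{#Rel x y z, Fm y (CWand A B), Fm x A#}"]) (auto simp: add_mset_commute)
next
  assume *: "\<forall>x z. Rel y x z \<in> X \<and> Fm x A \<in> X \<longrightarrow> Fm z B \<in> X"
  show "Fm y (CWand A B) \<in> X"
  proof (rule ccontr)
    assume "Fm y (CWand A B) \<notin> X"
    then have "Fm y (CNeg (CWand A B)) \<in> X" by (simp add: neg_iff)
    from witnessed[OF this this] obtain x z
      where "Rel x y z \<in> X" "Fm x A \<in> X" "Fm z (CNeg B) \<in> X"
      by (auto simp: witnessed_def)
    with * show False by (metis neg_iff rel_comm)
  qed
qed

lemma rel_assoc: "Rel x y z \<in> X \<Longrightarrow> Rel u v x \<in> X \<Longrightarrow> \<exists>w. Rel u w z \<in> X \<and> Rel y v w \<in> X"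
  using witnessed[of "Rel x y z" "Rel u v x"] by (simp add: witnessed_def)

section \<open>Equality of labels as a congruence\<close>

definition equiv_label :: "'l label \<Rightarrow> 'l label \<Rightarrow> bool" (infix "\<approx>" 50) where
  "a \<approx> b \<longleftrightarrow> Rel Eps a b \<in> X"

text \<open>Replacement of selected occurrences of \<open>a\<close> by \<open>b\<close> or
  conversely is expressed by demanding that every renaming identifying \<open>a\<close> and
  \<open>b\<close> also identifies \<open>i\<close> and \<open>i'\<close>. By
  \<open>merge_eq\<close> only such renamings matter, and under them \<open>i'\<close> is a second
  copy of \<open>i\<close>, removed by contraction.\<close>

lemma replace_label:
  assumes "a \<approx> b" "i \<in> X"
    and "\<And>\<sigma> :: 'l label \<Rightarrow> 'l label. \<sigma> a = \<sigma> b \<Longrightarrow> ren_item \<sigma> (id :: 'p \<Rightarrow> 'p) i = ren_item \<sigma> id i'"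
  shows "i' \<in> X"
proof (rule closed)
  show "set_mset {#Rel Eps a b, i#} \<subseteq> X" using assms(1,2) by (simp add: equiv_label_def)
  fix \<Gamma> assume d: "add_mset i' ({#Rel Eps a b, i#} + \<Gamma>) \<turnstile> {#}"
  have "add_mset (Rel Eps a b) (add_mset i \<Gamma>) \<turnstile> {#}"
  proof (rule merge_eq)
    fix \<sigma> :: "'l label \<Rightarrow> 'l label" assume \<sigma>: "\<sigma> Eps = Eps" "\<sigma> a = \<sigma> b"
    show "renL \<sigma> id (add_mset (Rel Eps a b) (add_mset i \<Gamma>)) \<turnstile> renR \<sigma> id {#}"
      using derivable_ren[where \<sigma> = \<sigma> and h = id and \<Gamma>' = "{#}" and \<Delta>' = "{#}", OF d infinite_UNIV \<sigma>(1)] assms(3)[OF \<sigma>(2)]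
        contract[of "ren_item \<sigma> id i" "add_mset (ren_item \<sigma> id (Rel Eps a b)) (renL \<sigma> id \<Gamma>)" "{#}"]
      by (simp add: add_mset_commute)
  qed
  then show "{#Rel Eps a b, i#} + \<Gamma> \<turnstile> {#}" by simp
qed

lemma equiv_refl: "a \<approx> a"
proof -
  have "Rel a Eps a \<in> X" by (rule closed[of "{#}"]) (use U[of a] in auto)
  then show ?thesis unfolding equiv_label_def by (rule rel_comm)
qed

text \<open>Starts from \<open>a \<approx> a\<close> and replaces only its left-hand
  \<open>a\<close>.\<close>

lemma equiv_sym: "a \<approx> b \<Longrightarrow> b \<approx> a"
  unfolding equiv_label_def[of b a]
  by (erule replace_label[of a b "Rel Eps a a"]) (use equiv_refl[of a] in \<open>simp_all add: equiv_label_def\<close>)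

lemma equiv_trans: "a \<approx> b \<Longrightarrow> b \<approx> c \<Longrightarrow> a \<approx> c"
  unfolding equiv_label_def[of a]
  by (erule replace_label[of b c "Rel Eps a b"]) simp_all

lemma rel_cong:
  assumes "Rel a b c \<in> X" "a \<approx> a'" "b \<approx> b'" "c \<approx> c'"
  shows "Rel a' b' c' \<in> X"
proof -
  have "Rel a' b c \<in> X" by (rule replace_label[OF assms(2,1)]) simp
  then have "Rel a' b' c \<in> X" by (rule replace_label[OF assms(3)]) simp
  then show ?thesis by (rule replace_label[OF assms(4)]) simp
qed

lemma fm_cong: "Fm a A \<in> X \<Longrightarrow> a \<approx> b \<Longrightarrow> Fm b A \<in> X"
  by (erule replace_label[rotated]) simp_all

lemma emp_iff: "Fm a CEmp \<in> X \<longleftrightarrow> a \<approx> Eps"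
proof
  have "Fm Eps CEmp \<in> X" by (rule deducible[of "{#}"]) (use empR[of _ "{#}"] in auto)
  then show "a \<approx> Eps \<Longrightarrow> Fm a CEmp \<in> X" using fm_cong equiv_sym by blast
next
  assume a: "Fm a CEmp \<in> X"
  show "a \<approx> Eps"
  proof (cases "a = Eps")
    case True
    then show ?thesis using equiv_refl by simp
  next
    case False
    have "Rel Eps a Eps \<in> X"
    proof (rule closed)
      show "set_mset {#Fm a CEmp#} \<subseteq> X" using a by simp
      fix \<Gamma> assume d: "add_mset (Rel Eps a Eps) ({#Fm a CEmp#} + \<Gamma>) \<turnstile> {#}"
      \<comment> \<open>After \<open>Eps\<close> is put for \<open>a\<close>, the added atom is
        discharged by \<open>U\<close> and the formula is cut against \<open>empR\<close>;
        \<open>empL\<close> then restores the original labels.\<close>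
      have "{#Rel Eps Eps Eps, Fm Eps CEmp#} + subL Eps a \<Gamma> \<turnstile> {#}"
        using derivable_ren[OF d infinite_UNIV, of "sub Eps a" id "{#}" "{#}"]
        by (simp add: sub_def subL_def sub_item_ren)
      then have "{#Fm Eps CEmp#} + subL Eps a \<Gamma> \<turnstile> {#}"
        using U[of Eps "{#Fm Eps CEmp#} + subL Eps a \<Gamma>" "{#}"]
        by (simp add: add_mset_commute)
      then have "subL Eps a \<Gamma> \<turnstile> {#}"
        using cut[of "{#}" Eps CEmp "{#}" "subL Eps a \<Gamma>" "{#}"] empR[of "{#}" "{#}"] by simp
      then show "{#Fm a CEmp#} + \<Gamma> \<turnstile> {#}" using empL[of a \<Gamma> "{#}"] False by simp
    qed
    then show ?thesis by (simp add: equiv_label_def)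
  qed
qed

section \<open>Quotient and truth lemma\<close>

lemma quotient_map:
  assumes "infinite (UNIV :: 'm set)"
  obtains q :: "'l label \<Rightarrow> 'm" where "\<And>a b. q a = q b \<longleftrightarrow> a \<approx> b"
proof -
  \<comment> \<open>The quotient has to live inside \<open>'m\<close>: a class is given by a chosen
    representative, coded by a number, and the numbers embed into any infinite type.\<close>
  obtain j :: "nat \<Rightarrow> 'm" where j: "inj j" using infinite_countable_subset[OF assms] by blast
  define rep where "rep a = (SOME b. a \<approx> b)" for a
  have rep: "a \<approx> rep a" for a unfolding rep_def by (rule someI[of _ a]) (rule equiv_refl)
  have "rep a = rep b \<longleftrightarrow> a \<approx> b" for a b
  proof
    assume "rep a = rep b"
    then show "a \<approx> b" using rep[of a] rep[of b] equiv_sym equiv_trans by metis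
  next
    assume "a \<approx> b"
    \<comment> \<open>Equal predicates give equal choices, so equivalent labels share their
      representative.\<close>
    then have "(\<lambda>c. a \<approx> c) = (\<lambda>c. b \<approx> c)" using equiv_sym equiv_trans by blast
    then show "rep a = rep b" by (simp add: rep_def)
  qed
  with j that[of "\<lambda>a. j (to_nat (rep a))"] show ?thesis by (simp add: inj_eq)
qed

theorem canonical_model:
  assumes "infinite (UNIV :: 'm set)"
  obtains M R e and v :: "'p \<Rightarrow> 'm set" and q :: "'l label \<Rightarrow> 'm"
  where "model M R e v" "\<And>a. q a \<in> M" "\<And>a A. forces R e v (q a) A \<longleftrightarrow> Fm a (unabbrev A) \<in> X"
proof -
  obtain q :: "'l label \<Rightarrow> 'm" where q: "\<And>a b. q a = q b \<longleftrightarrow> a \<approx> b"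
    using quotient_map[OF assms] by blast
  define R where "R = {(q a, q b, q c) | a b c. Rel a b c \<in> X}"
  define v where "v p = {q a | a. Fm a (CAtom p) \<in> X}" for p
  have R: "(q a, q b, q c) \<in> R \<longleftrightarrow> Rel a b c \<in> X" for a b c
  proof
    assume "(q a, q b, q c) \<in> R"
    then obtain a' b' c' where "a' \<approx> a" "b' \<approx> b" "c' \<approx> c" "Rel a' b' c' \<in> X"
      unfolding R_def by (auto simp: q intro: equiv_sym)
    then show "Rel a b c \<in> X" by (blast intro: rel_cong)
  qed (auto simp: R_def)
  have R_range: "R \<subseteq> range q \<times> range q \<times> range q" by (auto simp: R_def)
  \<comment> \<open>The quantifiers in \<open>forces\<close> range over all of \<open>'m\<close>;
    this restricts them to images of labels.\<close>
  then have range: "\<exists>x y z. a = q x \<and> b = q y \<and> c = q z" if "(a, b, c) \<in> R" for a b c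
    using that by blast
  have "frame (range q) R (q Eps)"
    unfolding frame_def
  proof (intro conjI ballI impI)
    fix a b c d assume "a \<in> range q" "b \<in> range q" "c \<in> range q" "d \<in> range q"
      "\<exists>k\<in>range q. (a, k, d) \<in> R \<and> (b, c, k) \<in> R"
    then obtain a' b' c' d' k where
      [simp]: "a = q a'" "b = q b'" "c = q c'" "d = q d'" and "Rel a' k d' \<in> X" "Rel b' c' k \<in> X"
      by (auto simp: R)
    \<comment> \<open>Rule \<open>A\<close> regroups a product whose left factor is composite, the
      frame condition one whose right factor is; commutativity mediates.\<close>
    then obtain l where "Rel c' l d' \<in> X" "Rel a' b' l \<in> X"
      using rel_assoc[of k a' d' c' b'] rel_comm by blast
    then show "\<exists>l\<in>range q. (a, b, l) \<in> R \<and> (l, c, d) \<in> R" using rel_comm by (auto simp: R)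
  qed (use R_range rel_comm in \<open>auto simp: R q equiv_label_def\<close>)
  then have "model (range q) R (q Eps) v" by (auto simp: model_def v_def)
  moreover have "forces R (q Eps) v (q a) A \<longleftrightarrow> Fm a (unabbrev A) \<in> X" for a A
  proof (induction A arbitrary: a)
    case (Atom p)
    show ?case unfolding forces.simps v_def mem_Collect_eq q unabbrev.simps by (metis fm_cong equiv_sym equiv_refl)
  next
    case (Star A B)
    have "forces R (q Eps) v (q a) (Star A B) \<longleftrightarrow> (\<exists>x y. (q x, q y, q a) \<in> R \<and>
        forces R (q Eps) v (q x) A \<and> forces R (q Eps) v (q y) B)"
      unfolding forces.simps by (metis range)
    then show ?case by (simp add: R Star star_iff)
  next
    case (Wand A B)
    have "forces R (q Eps) v (q a) (Wand A B) \<longleftrightarrow> (\<forall>x z. (q a, q x, q z) \<in> R \<and>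
        forces R (q Eps) v (q x) A \<longrightarrow> forces R (q Eps) v (q z) B)"
      unfolding forces.simps by (metis range)
    then show ?case by (simp add: R Wand wand_iff)
  qed (auto simp: q top_in bot_notin neg_iff imp_iff and_iff emp_iff)
  ultimately show ?thesis using that[of "range q" R "q Eps" v q] by blast
qed

end

subsection \<open>Completeness\<close>

lemma countermodel:
  fixes A :: "'p::countable fm" and w :: "'l::{infinite, countable}"
  assumes "infinite (UNIV :: 'm set)" "\<not> {#} \<turnstile> {#(Var w, unabbrev A)#}"
  obtains M R e and v :: "'p \<Rightarrow> 'm set" and m where "model M R e v" "m \<in> M" "\<not> forces R e v m A"
proof -
  let ?i = "Fm (Var w) (CNeg (unabbrev A))"
  have "con {?i}"
    unfolding con_def
  proof (intro allI impI notI)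
    fix \<Gamma> assume \<Gamma>: "set_mset \<Gamma> \<subseteq> {?i}" "\<Gamma> \<turnstile> {#}"
    have "\<Gamma> + {#?i#} \<turnstile> {#}" by (rule weaken[OF \<Gamma>(2)]) simp_all
    then have "{#?i#} \<turnstile> {#}" by (rule contract_set) (use \<Gamma>(1) in simp)
    then show False using neg_right[of "Var w" "unabbrev A" "{#}"] assms(2) by simp
  qed
  then obtain X where X: "{?i} \<subseteq> X" "con X"
    "\<And>i j. con (X \<union> {i, j}) \<Longrightarrow> i \<in> X \<and> j \<in> X \<and> witnessed i j X"
    using henkin_extension[of "{?i}"] by blast
  interpret henkin X by unfold_locales (use X in blast)+
  have "Fm (Var w) (unabbrev A) \<notin> X" using X(1) neg_iff by blast
  then show ?thesis using canonical_model[OF assms(1)] that by metis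
qed

lemma finite_set_fm: "finite (set_fm A)"
  by (induction A) simp_all

lemma unabbrev_map: "unabbrev (map_fm k A) = map_cfm k (unabbrev A)"
  by (induction A) simp_all

lemma forces_map: "forces R e v m (map_fm k A) \<longleftrightarrow> forces R e (v \<circ> k) m A"
  by (induction A arbitrary: m) simp_all

text \<open>The canonical model needs countably many labels and atoms, so the atoms of \<open>A\<close> are first coded
  by numbers, and the derivation over labels in \<open>nat\<close> is renamed at the end.\<close>

theorem theorem2:
  fixes A :: "'p fm" and w :: "'l"
  assumes "infinite (UNIV :: 'l set)"
    and "infinite (UNIV :: 'm set)"
    and "valid TYPE('m) A"
  shows "{#} \<turnstile> {#(Var w, unabbrev A)#}"
proof -
  obtain k :: "'p \<Rightarrow> nat" where k: "inj_on k (set_fm A)"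
    using finite_imp_inj_to_nat_seg[OF finite_set_fm[of A]] by blast
  define h where "h = inv_into (set_fm A) k"
  \<comment> \<open>\<open>h\<close> inverts \<open>k\<close> only on the atoms of \<open>A\<close>,
    which is all that the congruence rule for \<open>map_fm\<close> requires.\<close>
  have "map_fm (h \<circ> k) A = map_fm id A" by (rule fm.map_cong[OF refl]) (use k in \<open>simp add: h_def\<close>)
  then have h: "map_fm h (map_fm k A) = A" by (simp add: fm.map_comp fm.map_id)
  have "{#} \<turnstile> {#(Var (0 :: nat), unabbrev (map_fm k A))#}"
  proof (rule ccontr)
    assume "\<not> {#} \<turnstile> {#(Var (0 :: nat), unabbrev (map_fm k A))#}"
    then obtain M R e m and v :: "nat \<Rightarrow> 'm set"
      where "model M R e v" "m \<in> M" "\<not> forces R e v m (map_fm k A)"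
      by (rule countermodel[OF assms(2)])
    \<comment> \<open>Precomposition with the coding turns the countermodel for the coded formula
      into one for \<open>A\<close>.\<close>
    moreover from this have "model M R e (v \<circ> k)" by (simp add: model_def)
    ultimately show False using assms(3) by (auto simp: valid_def forces_map)
  qed
  \<comment> \<open>Every variable can be sent to \<open>w\<close> because the renaming need not be
    injective; \<open>h\<close> decodes the atoms at the same time.\<close>
  from derivable_ren[OF this assms(1), of "\<lambda>l. if l = Eps then Eps else Var w" h "{#}" "{#}"]
  show ?thesis by (simp add: unabbrev_map[symmetric] h)
qed

end
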